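(* Let $\mathbb{K}=\mathbb{R}$ or $\mathbb{K}=\mathbb{C}$ and let $(\Omega,\Sigma,\mu)$ be a measure space. Let $f,g,h\in L^2(\Omega,\mathbb{K})$ and $\gamma,\Gamma\in\mathbb{K}$ be such that $\int_\Omega|h(s)|^2\,d\mu(s)=1$. Put $$I:=\int_\Omega\operatorname{Re}\left[f(s)\overline{g(s)}\right]d\mu(s)-\operatorname{Re}\left[\int_\Omega f(s)\overline{h(s)}\,d\mu(s)\cdot\int_\Omega h(s)\overline{g(s)}\,d\mu(s)\right].$$ For a sign $\sigma\in\{+1,-1\}$ consider the condition $$\int_\Omega\operatorname{Re}\left\{\left[\Gamma h(s)-\frac{f(s)+\sigma g(s)}{2}\right]\cdot\left[\frac{\overline{f(s)}+\sigma\overline{g(s)}}{2}-\overline{\gamma}\,\overline{h(s)}\right]\right\}d\mu(s)\ge 0,$$ or, equivalently, $$\left(\int_\Omega\left|\frac{f(s)+\sigma g(s)}{2}-\frac{\gamma+\Gamma}{2}h(s)\right|^2d\mu(s)\right)^{\frac12}\le\frac12|\Gamma-\gamma|.$$ (i) If this condition holds for $\sigma=+1$, then $I\le\frac14|\Gamma-\gamma|^2$. (ii) If this condition holds for both $\sigma=+1$ and $\sigma=-1$, then $|I|\le\frac14|\Gamma-\gamma|^2$.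
   Context: $\mu$ is a countably additive positive measure on the $\sigma$-algebra $\Sigma$ of subsets of $\Omega$, with values in $\mathbb{R}\cup\{\infty\}$. $L^2(\Omega,\mathbb{K})$ is the Hilbert space of $\mathbb{K}$-valued (measurable) functions $f$ on $\Omega$ with $\int_\Omega|f(s)|^2\,d\mu(s)<\infty$. *)

theory Defs
  imports "HOL-Analysis.Analysis"
begin

text \<open>
  The scalar field is a set \<open>K\<close> of complex numbers, \<open>\<real>\<close> or \<open>UNIV\<close>, so that the real and the
  complex case share one formula. Members of \<open>L2_fun M K\<close> are functions, not equivalence
  classes modulo equality almost everywhere; values outside \<open>space M\<close> are unconstrained.
\<close>

definition L2_fun :: "'a measure \<Rightarrow> complex set \<Rightarrow> ('a \<Rightarrow> complex) set" where
  "L2_fun M K = {f \<in> borel_measurable M.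
     (\<forall>s \<in> space M. f s \<in> K) \<and> (\<integral>\<^sup>+ s. ennreal ((cmod (f s))\<^sup>2) \<partial>M) < \<infinity>}"

definition gruss_functional ::
    "'a measure \<Rightarrow> ('a \<Rightarrow> complex) \<Rightarrow> ('a \<Rightarrow> complex) \<Rightarrow> ('a \<Rightarrow> complex) \<Rightarrow> real" where
  "gruss_functional M f g h =
     (\<integral>s. Re (f s * cnj (g s)) \<partial>M)
     - Re ((\<integral>s. f s * cnj (h s) \<partial>M) * (\<integral>s. h s * cnj (g s) \<partial>M))"

definition accretive_cond ::
    "'a measure \<Rightarrow> ('a \<Rightarrow> complex) \<Rightarrow> ('a \<Rightarrow> complex) \<Rightarrow> ('a \<Rightarrow> complex) \<Rightarrow>
     complex \<Rightarrow> complex \<Rightarrow> complex \<Rightarrow> bool" where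
  "accretive_cond M f g h \<gamma> \<Gamma> \<sigma> \<longleftrightarrow>
     (\<integral>s. Re ((\<Gamma> * h s - (f s + \<sigma> * g s) / 2)
             * ((cnj (f s) + \<sigma> * cnj (g s)) / 2 - cnj \<gamma> * cnj (h s))) \<partial>M) \<ge> 0"

definition ball_cond ::
    "'a measure \<Rightarrow> ('a \<Rightarrow> complex) \<Rightarrow> ('a \<Rightarrow> complex) \<Rightarrow> ('a \<Rightarrow> complex) \<Rightarrow>
     complex \<Rightarrow> complex \<Rightarrow> complex \<Rightarrow> bool" where
  "ball_cond M f g h \<gamma> \<Gamma> \<sigma> \<longleftrightarrow>
     sqrt (\<integral>s. (cmod ((f s + \<sigma> * g s) / 2 - (\<gamma> + \<Gamma>) / 2 * h s))\<^sup>2 \<partial>M)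
       \<le> 1 / 2 * cmod (\<Gamma> - \<gamma>)"

end

theory Submission
  imports Defs
begin

text \<open>
  Write \<open>\<langle>u, v\<rangle>\<close> for the integral of \<open>u * cnj v\<close>, and let \<open>D u = \<langle>u, u\<rangle> - \<bar>\<langle>u, h\<rangle>\<bar>\<^sup>2\<close> be the squared
  distance of \<open>u\<close> from the line spanned by the unit vector \<open>h\<close>. The form
  \<open>\<langle>f, g\<rangle> - \<langle>f, h\<rangle> \<langle>h, g\<rangle>\<close> is Hermitian with quadratic form \<open>D\<close>, so for its real part \<open>I\<close>
  polarization gives
  \<open>I = D ((f + g) / 2) - D ((f - g) / 2)\<close> (\<open>gruss_functional_polarization\<close>).

  Pythagoras (\<open>square_distance_from_multiple\<close>) shows that \<open>D\<close> is nonnegative and that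
  \<open>D u \<le> \<parallel>u - c h\<parallel>\<^sup>2\<close> for every scalar \<open>c\<close>. The ball condition with sign \<open>\<sigma>\<close> bounds this distance
  for \<open>u = (f + \<sigma> g) / 2\<close> and \<open>c = (\<gamma> + \<Gamma>) / 2\<close>, so it gives
  \<open>D ((f + \<sigma> g) / 2) \<le> \<bar>\<Gamma> - \<gamma>\<bar>\<^sup>2 / 4\<close>. The sign \<open>+1\<close> therefore bounds \<open>I\<close> from above and the sign
  \<open>-1\<close> bounds it from below.

  The two forms of the condition are equivalent because a segment is a diameter of a ball: the
  integrand \<open>Re ((\<Gamma> h - p) * cnj (p - \<gamma> h))\<close> is the squared radius \<open>\<bar>\<Gamma> - \<gamma>\<bar>\<^sup>2 \<bar>h\<bar>\<^sup>2 / 4\<close> minus the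
  squared distance of \<open>p\<close> from the midpoint of \<open>\<gamma> h\<close> and \<open>\<Gamma> h\<close>
  (\<open>accretive_iff_in_ball\<close>).

  Real-valued square-integrable functions are among the complex-valued ones, and the inequalities
  involve only norms and real parts, so the argument takes place in complex \<open>L\<^sup>2\<close> throughout.
\<close>

section \<open>Square-integrable functions\<close>

lemma L2_fun_subset_UNIV: "L2_fun M K \<subseteq> L2_fun M UNIV"
  by (auto simp: L2_fun_def)

lemma L2_fun_UNIV_iff:
  "f \<in> L2_fun M UNIV \<longleftrightarrow> f \<in> borel_measurable M \<and> integrable M (\<lambda>s. (cmod (f s))\<^sup>2)"
  by (auto simp: L2_fun_def integrable_iff_bounded)

lemma L2_fun_cmult:
  assumes "f \<in> L2_fun M UNIV"
  shows "(\<lambda>s. c * f s) \<in> L2_fun M UNIV"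
  using assms by (auto simp: L2_fun_UNIV_iff norm_mult power_mult_distrib)

lemma integrable_mult_cnj:
  assumes "f \<in> L2_fun M UNIV" and "g \<in> L2_fun M UNIV"
  shows "integrable M (\<lambda>s. f s * cnj (g s))"
proof (rule Bochner_Integration.integrable_bound)
  show "integrable M (\<lambda>s. (cmod (f s))\<^sup>2 + (cmod (g s))\<^sup>2)"
    using assms by (auto simp: L2_fun_UNIV_iff)
  have [measurable]: "f \<in> borel_measurable M" "g \<in> borel_measurable M"
    using assms by (auto simp: L2_fun_UNIV_iff)
  have "(\<lambda>s. cnj (g s)) \<in> borel_measurable M"
    by (rule borel_measurable_continuous_on[of cnj]) (auto intro: continuous_intros)
  then show "(\<lambda>s. f s * cnj (g s)) \<in> borel_measurable M"
    by simp
  have "x * y \<le> x\<^sup>2 + y\<^sup>2" if "0 \<le> x" "0 \<le> y" for x y :: real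
    using sum_squares_bound[of x y] mult_nonneg_nonneg[OF that] by linarith
  then show "AE s in M. norm (f s * cnj (g s)) \<le> norm ((cmod (f s))\<^sup>2 + (cmod (g s))\<^sup>2)"
    by (simp add: norm_mult)
qed

lemma cmod_add_square:
  "(cmod (a + b))\<^sup>2 = (cmod a)\<^sup>2 + 2 * Re (a * cnj b) + (cmod b)\<^sup>2"
  unfolding cmod_power2 by (simp add: power2_eq_square algebra_simps)

lemma L2_fun_add:
  assumes "f \<in> L2_fun M UNIV" and "g \<in> L2_fun M UNIV"
  shows "(\<lambda>s. f s + g s) \<in> L2_fun M UNIV"
  using assms integrable_Re[OF integrable_mult_cnj[OF assms]]
  unfolding L2_fun_UNIV_iff cmod_add_square by (auto simp del: times_complex.simps)

lemma L2_fun_diff_cmult: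
  assumes "u \<in> L2_fun M UNIV" and "h \<in> L2_fun M UNIV"
  shows "(\<lambda>s. u s - c * h s) \<in> L2_fun M UNIV"
  using L2_fun_add[OF assms(1) L2_fun_cmult[OF assms(2), of "- c"]] by simp

lemma L2_fun_half_combination:
  assumes "f \<in> L2_fun M UNIV" and "g \<in> L2_fun M UNIV"
  shows "(\<lambda>s. (f s + \<sigma> * g s) / 2) \<in> L2_fun M UNIV"
  using L2_fun_cmult[OF L2_fun_add[OF assms(1) L2_fun_cmult[OF assms(2), of \<sigma>]], of "1 / 2"]
  by simp

section \<open>Distance from the line spanned by a unit vector\<close>

text \<open>
  For a unit vector \<open>h\<close> this is the squared norm of the component of \<open>u\<close> orthogonal to \<open>h\<close>.
\<close>

definition residual_energy :: "'a measure \<Rightarrow> ('a \<Rightarrow> complex) \<Rightarrow> ('a \<Rightarrow> complex) \<Rightarrow> real" where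
  "residual_energy M h u =
     (\<integral>s. (cmod (u s))\<^sup>2 \<partial>M) - (cmod (\<integral>s. u s * cnj (h s) \<partial>M))\<^sup>2"

text \<open>
  Pythagoras: \<open>u - c h\<close> is the sum of the component of \<open>u\<close> orthogonal to \<open>h\<close> and of a multiple of
  \<open>h\<close> with coefficient \<open>\<langle>u, h\<rangle> - c\<close>.
\<close>

lemma square_distance_from_multiple:
  assumes u: "u \<in> L2_fun M UNIV" and h: "h \<in> L2_fun M UNIV"
    and unit: "(\<integral>s. (cmod (h s))\<^sup>2 \<partial>M) = 1"
  shows "(\<integral>s. (cmod (u s - c * h s))\<^sup>2 \<partial>M)
    = residual_energy M h u + (cmod ((\<integral>s. u s * cnj (h s) \<partial>M) - c))\<^sup>2"
proof -
  let ?a = "\<integral>s. u s * cnj (h s) \<partial>M"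
  note uh = integrable_mult_cnj[OF u h]
  have expand: "(cmod (x - c * y))\<^sup>2
      = (cmod x)\<^sup>2 - 2 * Re (cnj c * (x * cnj y)) + (cmod c)\<^sup>2 * (cmod y)\<^sup>2" for x y
    unfolding cmod_power2 by (simp add: power2_eq_square algebra_simps)
  have "(\<integral>s. (cmod (u s - c * h s))\<^sup>2 \<partial>M)
      = (\<integral>s. (cmod (u s))\<^sup>2 \<partial>M) - 2 * Re (cnj c * ?a) + (cmod c)\<^sup>2"
  proof -
    have "integrable M (\<lambda>s. (cmod (u s))\<^sup>2)" "integrable M (\<lambda>s. (cmod (h s))\<^sup>2)"
      using u h by (auto simp: L2_fun_UNIV_iff)
    moreover have "integrable M (\<lambda>s. cnj c * (u s * cnj (h s)))"
      using uh by (rule integrable_mult_right)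
    moreover from this have "integrable M (\<lambda>s. Re (cnj c * (u s * cnj (h s))))"
      by (rule integrable_Re)
    moreover have "(\<integral>s. Re (cnj c * (u s * cnj (h s))) \<partial>M) = Re (cnj c * ?a)"
      using integral_Re[OF calculation(3)] by simp
    ultimately show ?thesis
      unfolding expand using unit
      by (simp del: times_complex.simps complex_cnj_mult)
  qed
  also have "\<dots> = residual_energy M h u + (cmod (?a - c))\<^sup>2"
    unfolding residual_energy_def using expand[of ?a 1] by (simp add: algebra_simps)
  finally show ?thesis .
qed

lemma residual_energy_le_square_distance:
  assumes "u \<in> L2_fun M UNIV" and "h \<in> L2_fun M UNIV"
    and "(\<integral>s. (cmod (h s))\<^sup>2 \<partial>M) = 1"
  shows "residual_energy M h u \<le> (\<integral>s. (cmod (u s - c * h s))\<^sup>2 \<partial>M)"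
  by (simp add: square_distance_from_multiple[OF assms])

text \<open>
  This is the Cauchy--Schwarz inequality for \<open>u\<close> and \<open>h\<close>: the residual energy is attained as the
  squared distance from the orthogonal projection, whose coefficient is \<open>\<langle>u, h\<rangle>\<close>.
\<close>

lemma residual_energy_nonneg:
  assumes "u \<in> L2_fun M UNIV" and "h \<in> L2_fun M UNIV"
    and "(\<integral>s. (cmod (h s))\<^sup>2 \<partial>M) = 1"
  shows "0 \<le> residual_energy M h u"
proof -
  have "residual_energy M h u
      = (\<integral>s. (cmod (u s - (\<integral>t. u t * cnj (h t) \<partial>M) * h s))\<^sup>2 \<partial>M)"
    by (simp add: square_distance_from_multiple[OF assms])
  then show ?thesis
    by simp
qed

section \<open>Polarization of the Gruss functional\<close>

lemma Re_mult_cnj_polarization: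
  "Re (a * cnj b) = (cmod ((a + b) / 2))\<^sup>2 - (cmod ((a - b) / 2))\<^sup>2"
  unfolding cmod_power2 by (simp add: power2_eq_square field_simps)

lemma gruss_functional_polarization:
  assumes f: "f \<in> L2_fun M UNIV" and g: "g \<in> L2_fun M UNIV" and h: "h \<in> L2_fun M UNIV"
  shows "gruss_functional M f g h
    = residual_energy M h (\<lambda>s. (f s + g s) / 2) - residual_energy M h (\<lambda>s. (f s - g s) / 2)"
proof -
  let ?a = "\<integral>s. f s * cnj (h s) \<partial>M" and ?b = "\<integral>s. g s * cnj (h s) \<partial>M"
  note fh = integrable_mult_cnj[OF f h] and gh = integrable_mult_cnj[OF g h]
  have "(\<lambda>s. (f s + g s) / 2) \<in> L2_fun M UNIV" "(\<lambda>s. (f s - g s) / 2) \<in> L2_fun M UNIV"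
    using L2_fun_half_combination[OF f g, of 1] L2_fun_half_combination[OF f g, of "-1"] by simp_all
  then have fg: "(\<integral>s. Re (f s * cnj (g s)) \<partial>M)
      = (\<integral>s. (cmod ((f s + g s) / 2))\<^sup>2 \<partial>M) - (\<integral>s. (cmod ((f s - g s) / 2))\<^sup>2 \<partial>M)"
    unfolding Re_mult_cnj_polarization L2_fun_UNIV_iff
    by (intro Bochner_Integration.integral_diff) auto
  have "(\<integral>s. (f s + g s) / 2 * cnj (h s) \<partial>M) = (?a + ?b) / 2"
    "(\<integral>s. (f s - g s) / 2 * cnj (h s) \<partial>M) = (?a - ?b) / 2"
    using fh gh by (simp_all add: ring_distribs)
  moreover have "(\<integral>s. h s * cnj (g s) \<partial>M) = cnj ?b"
    using Bochner_Integration.integral_cnj[of M "\<lambda>s. g s * cnj (h s)"] by (simp add: mult.commute)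
  ultimately show ?thesis
    unfolding gruss_functional_def residual_energy_def fg
    using Re_mult_cnj_polarization[of ?a ?b] by simp
qed

section \<open>The two forms of the condition\<close>

text \<open>
  In the complex plane, \<open>Re ((y - p) * cnj (p - x)) \<ge> 0\<close> says, for \<open>p\<close> other than \<open>x\<close> and
  \<open>y\<close>, that the angle at \<open>p\<close> subtended by the segment from \<open>x\<close> to \<open>y\<close> is at least a right angle. By Thales this means that \<open>p\<close> lies in the
  disc with that segment as a diameter; quantitatively, the left-hand side is the negative of the
  power of the point \<open>p\<close>.
\<close>

lemma Re_mult_cnj_diameter:
  "Re ((y - p) * cnj (p - x)) = (cmod (y - x))\<^sup>2 / 4 - (cmod (p - (x + y) / 2))\<^sup>2"
  unfolding cmod_power2 by (simp add: power2_eq_square field_simps)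

lemma accretive_iff_in_ball:
  assumes p: "p \<in> L2_fun M UNIV" and h: "h \<in> L2_fun M UNIV"
    and unit: "(\<integral>s. (cmod (h s))\<^sup>2 \<partial>M) = 1"
  shows "0 \<le> (\<integral>s. Re ((\<Gamma> * h s - p s) * cnj (p s - \<gamma> * h s)) \<partial>M)
    \<longleftrightarrow> (\<integral>s. (cmod (p s - (\<gamma> + \<Gamma>) / 2 * h s))\<^sup>2 \<partial>M) \<le> (cmod (\<Gamma> - \<gamma>))\<^sup>2 / 4"
proof -
  have int: "integrable M (\<lambda>s. (cmod (h s))\<^sup>2)"
    "integrable M (\<lambda>s. (cmod (p s - (\<gamma> + \<Gamma>) / 2 * h s))\<^sup>2)"
    using h L2_fun_diff_cmult[OF p h, of "(\<gamma> + \<Gamma>) / 2"] unfolding L2_fun_UNIV_iff by auto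
  have "Re ((\<Gamma> * h s - p s) * cnj (p s - \<gamma> * h s))
      = (cmod (\<Gamma> - \<gamma>))\<^sup>2 / 4 * (cmod (h s))\<^sup>2 - (cmod (p s - (\<gamma> + \<Gamma>) / 2 * h s))\<^sup>2" for s
  proof -
    have "\<Gamma> * h s - \<gamma> * h s = (\<Gamma> - \<gamma>) * h s"
      "(\<gamma> * h s + \<Gamma> * h s) / 2 = (\<gamma> + \<Gamma>) / 2 * h s"
      by (simp_all add: algebra_simps)
    then show ?thesis
      unfolding Re_mult_cnj_diameter by (simp only: norm_mult power_mult_distrib times_divide_eq_left)
  qed
  then have "(\<integral>s. Re ((\<Gamma> * h s - p s) * cnj (p s - \<gamma> * h s)) \<partial>M)
      = (cmod (\<Gamma> - \<gamma>))\<^sup>2 / 4 - (\<integral>s. (cmod (p s - (\<gamma> + \<Gamma>) / 2 * h s))\<^sup>2 \<partial>M)"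
    using int unit by (simp del: times_complex.simps)
  then show ?thesis
    by simp
qed

lemma ball_cond_iff:
  "ball_cond M f g h \<gamma> \<Gamma> \<sigma> \<longleftrightarrow>
     (\<integral>s. (cmod ((f s + \<sigma> * g s) / 2 - (\<gamma> + \<Gamma>) / 2 * h s))\<^sup>2 \<partial>M) \<le> (cmod (\<Gamma> - \<gamma>))\<^sup>2 / 4"
proof -
  have "sqrt x \<le> 1 / 2 * d \<longleftrightarrow> x \<le> d\<^sup>2 / 4" if "0 \<le> d" for x d :: real
    using real_sqrt_le_iff[of x "(1 / 2 * d)\<^sup>2"] that
    by (simp add: real_sqrt_divide power_mult_distrib power_divide del: real_sqrt_le_iff)
  then show ?thesis
    unfolding ball_cond_def by (simp only: norm_ge_zero)
qed

text \<open>
  The second factor of the accretivity condition contains \<open>\<sigma>\<close> rather than its conjugate;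
  reality of \<open>\<sigma>\<close> makes that factor the conjugate of \<open>(f + \<sigma> g) / 2 - \<gamma> h\<close>.
\<close>

lemma accretive_cond_iff_ball_cond:
  assumes "f \<in> L2_fun M UNIV" and "g \<in> L2_fun M UNIV" and "h \<in> L2_fun M UNIV"
    and "(\<integral>s. (cmod (h s))\<^sup>2 \<partial>M) = 1" and "cnj \<sigma> = \<sigma>"
  shows "accretive_cond M f g h \<gamma> \<Gamma> \<sigma> \<longleftrightarrow> ball_cond M f g h \<gamma> \<Gamma> \<sigma>"
  using accretive_iff_in_ball[OF L2_fun_half_combination[OF assms(1,2)] assms(3,4), of \<Gamma> \<sigma> \<gamma>]
  unfolding accretive_cond_def ball_cond_iff by (simp add: assms(5) del: times_complex.simps)

lemma residual_energy_le_if_ball_cond: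
  assumes "f \<in> L2_fun M UNIV" and "g \<in> L2_fun M UNIV" and "h \<in> L2_fun M UNIV"
    and "(\<integral>s. (cmod (h s))\<^sup>2 \<partial>M) = 1" and "ball_cond M f g h \<gamma> \<Gamma> \<sigma>"
  shows "residual_energy M h (\<lambda>s. (f s + \<sigma> * g s) / 2) \<le> (cmod (\<Gamma> - \<gamma>))\<^sup>2 / 4"
  using residual_energy_le_square_distance[OF L2_fun_half_combination[OF assms(1,2)] assms(3,4)]
    assms(5) unfolding ball_cond_iff by (rule order_trans)

section \<open>The Gruss inequality\<close>

theorem proposition3:
  fixes M :: "'a measure" and K :: "complex set"
    and f g h :: "'a \<Rightarrow> complex" and \<gamma> \<Gamma> :: complex
  assumes "K = \<real> \<or> K = UNIV"
    and "f \<in> L2_fun M K" and "g \<in> L2_fun M K" and "h \<in> L2_fun M K"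
    and "\<gamma> \<in> K" and "\<Gamma> \<in> K"
    and "(\<integral>s. (cmod (h s))\<^sup>2 \<partial>M) = 1"
  shows "(\<forall>\<sigma>\<in>{1, -1}. accretive_cond M f g h \<gamma> \<Gamma> \<sigma> \<longleftrightarrow> ball_cond M f g h \<gamma> \<Gamma> \<sigma>)
    \<and> (accretive_cond M f g h \<gamma> \<Gamma> 1 \<longrightarrow>
         gruss_functional M f g h \<le> 1 / 4 * (cmod (\<Gamma> - \<gamma>))\<^sup>2)
    \<and> (accretive_cond M f g h \<gamma> \<Gamma> 1 \<and> accretive_cond M f g h \<gamma> \<Gamma> (-1) \<longrightarrow>
         \<bar>gruss_functional M f g h\<bar> \<le> 1 / 4 * (cmod (\<Gamma> - \<gamma>))\<^sup>2)"
proof -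
  have L2: "f \<in> L2_fun M UNIV" "g \<in> L2_fun M UNIV" "h \<in> L2_fun M UNIV"
    using assms(2-4) L2_fun_subset_UNIV by blast+
  note unit = assms(7)
  let ?r = "1 / 4 * (cmod (\<Gamma> - \<gamma>))\<^sup>2"
  let ?Dp = "residual_energy M h (\<lambda>s. (f s + g s) / 2)"
  let ?Dm = "residual_energy M h (\<lambda>s. (f s - g s) / 2)"
  have equiv: "accretive_cond M f g h \<gamma> \<Gamma> \<sigma> \<longleftrightarrow> ball_cond M f g h \<gamma> \<Gamma> \<sigma>"
    if "\<sigma> \<in> {1, -1}" for \<sigma>
    using that by (intro accretive_cond_iff_ball_cond[OF L2 unit]) auto
  have I: "gruss_functional M f g h = ?Dp - ?Dm"
    by (rule gruss_functional_polarization[OF L2])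
  have nonneg: "0 \<le> ?Dp" "0 \<le> ?Dm"
    using L2_fun_half_combination[OF L2(1,2), of 1] L2_fun_half_combination[OF L2(1,2), of "-1"]
    by (auto intro!: residual_energy_nonneg[OF _ L2(3) unit])
  have plus: "?Dp \<le> ?r" if "accretive_cond M f g h \<gamma> \<Gamma> 1"
    using residual_energy_le_if_ball_cond[OF L2 unit, of \<gamma> \<Gamma> 1] that equiv[of 1] by simp
  have minus: "?Dm \<le> ?r" if "accretive_cond M f g h \<gamma> \<Gamma> (-1)"
    using residual_energy_le_if_ball_cond[OF L2 unit, of \<gamma> \<Gamma> "-1"] that equiv[of "-1"] by simp
  have "gruss_functional M f g h \<le> ?r" if "accretive_cond M f g h \<gamma> \<Gamma> 1"
    using plus[OF that] nonneg(2) unfolding I by linarith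
  moreover have "- ?r \<le> gruss_functional M f g h" if "accretive_cond M f g h \<gamma> \<Gamma> (-1)"
    using minus[OF that] nonneg(1) unfolding I by linarith
  ultimately show ?thesis
    unfolding abs_le_iff using equiv by (meson minus_le_iff)
qed

end
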